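(* Let $G$ be a nontrivial finite group with inverse-closed generating set $C$ such that $\Gamma=\mathrm{Cay}(G;C)$ is normal edge-transitive. Then there exist $k\geq 1$ and $N_1,\dots,N_k\in\mathcal{A}_{\max}(G;C)$ for which the following conditions (i) and (ii) hold for the subgroup $X:=\bigcap_{i=1}^k N_i$ and the quotient graphs $\Gamma_i:=\mathrm{Cay}(G/N_i;CN_i/N_i)$. (i) $X\in\mathcal{A}(G;C)$ and the map $\zeta: gX\mapsto (gN_1,\dots,gN_k)$ is a group isomorphism $G/X\to\prod_{i=1}^k G/N_i$. (ii) For each $i\leq k$, $\Gamma_i$ is a connected normal edge-transitive Cayley graph of the finite characteristically simple group $G/N_i$, and $\zeta$ induces a graph isomorphism from $\mathrm{Cay}(G/X;CX/X)$ onto a full subdirect product of $\prod_{i=1}^k\Gamma_i$. (iii) Moreover, among all subgroups $X=\bigcap_{i=1}^k N_i$ (over all $k\ge1$ and $N_1,\dots,N_k\in\mathcal{A}_{\max}(G;C)$) for which both (i) and (ii) hold, the unique smallest is $X=\Phi(G;C)$.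
   Context: An inverse-closed generating set $C$ for a finite group $G$ is a non-empty subset $C\subseteq G\setminus\{1\}$ with $\langle C\rangle=G$ and $c^{-1}\in C$ for each $c\in C$. $\mathrm{Aut}(G;C)=\{\sigma\in\mathrm{Aut}(G)\mid C^\sigma=C\}$. Define $\mathcal{A}(G;C)=\{N\mid N\unlhd G,\ N\neq G,\ N^\sigma=N \text{ for all }\sigma\in\mathrm{Aut}(G;C)\}$, let $\mathcal{A}_{\max}(G;C)$ be the set of elements of $\mathcal{A}(G;C)$ maximal under inclusion, and let $\Phi(G;C)=\bigcap\{N\mid N\in\mathcal{A}_{\max}(G;C)\}$. For $N\unlhd G$, $CN/N=\{cN\mid c\in C\}\subseteq G/N$. Cayley graphs: $\mathrm{Cay}(G;C)$ is the undirected graph with vertex set $G$ whose edges are all pairs $\{g,h\}$ with $gh^{-1}\in C$. For $g\in G$ let $\rho_g:h\mapsto hg$ and $G_R=\{\rho_g\mid g\in G\}$. The group $N(G;C)=G_R\rtimes\mathrm{Aut}(G;C)$ acts as automorphisms of $\mathrm{Cay}(G;C)$, and $\mathrm{Cay}(G;C)$ is called normal edge-transitive if $N(G;C)$ is transitive on its edge set. A group is characteristically simple if its only characteristic subgroups are itself and the trivial subgroup. Graphs are finite, simple and undirected. A subgraph of $(V,E)$ is a graph $(V',E')$ with $V'\subseteq V$ and $E'\subseteq E$. A graph homomorphism $(V_1,E_1)\to(V_2,E_2)$ is a map $f:V_1\to V_2$ sending each edge to an edge; it is an epimorphism if it is onto on vertices, and full if the induced map $E_1\to E_2$ is onto; a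 full epimorphism is one which is both; an isomorphism is a full homomorphism that is bijective on vertices. The direct product $\prod_{i=1}^k\Gamma_i$ of graphs $\Gamma_i=(V_i,E_i)$ has vertex set $V_1\times\dots\times V_k$, and $\{u,v\}$ is an edge if and only if $\{u_i,v_i\}\in E_i$ for every $i$. A full subdirect product of $\prod_{i=1}^k\Gamma_i$ is a subgraph $\Delta$ of this direct product such that, for each $i$, the projection $\pi_i:\Delta\to\Gamma_i$, $u\mapsto u_i$, is a full epimorphism. *)

theory Defs
  imports "HOL-Algebra.Generated_Groups" "HOL-Algebra.Product_Groups" "HOL-Algebra.Bij"
begin

section \<open>Finite simple undirected graphs\<close>

record 'v ugraph =
  verts :: "'v set"
  edges :: "'v set set"

definition simple_graph :: "'v ugraph \<Rightarrow> bool" where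
  "simple_graph \<Gamma> \<longleftrightarrow>
     finite (verts \<Gamma>) \<and> (\<forall>e\<in>edges \<Gamma>. \<exists>u\<in>verts \<Gamma>. \<exists>v\<in>verts \<Gamma>. u \<noteq> v \<and> e = {u, v})"

definition graph_connected :: "'v ugraph \<Rightarrow> bool" where
  "graph_connected \<Gamma> \<longleftrightarrow>
     (\<forall>u\<in>verts \<Gamma>. \<forall>v\<in>verts \<Gamma>. (u, v) \<in> {(x, y). {x, y} \<in> edges \<Gamma>}\<^sup>*)"

definition is_subgraph :: "'v ugraph \<Rightarrow> 'v ugraph \<Rightarrow> bool" where
  "is_subgraph \<Delta> \<Gamma> \<longleftrightarrow>
     simple_graph \<Delta> \<and> simple_graph \<Gamma> \<and> verts \<Delta> \<subseteq> verts \<Gamma> \<and> edges \<Delta> \<subseteq> edges \<Gamma>"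

definition graph_hom :: "'v ugraph \<Rightarrow> 'w ugraph \<Rightarrow> ('v \<Rightarrow> 'w) \<Rightarrow> bool" where
  "graph_hom \<Gamma> \<Delta> f \<longleftrightarrow>
     simple_graph \<Gamma> \<and> simple_graph \<Delta> \<and>
     f \<in> verts \<Gamma> \<rightarrow> verts \<Delta> \<and> (\<forall>e\<in>edges \<Gamma>. f ` e \<in> edges \<Delta>)"

definition graph_epi :: "'v ugraph \<Rightarrow> 'w ugraph \<Rightarrow> ('v \<Rightarrow> 'w) \<Rightarrow> bool" where
  "graph_epi \<Gamma> \<Delta> f \<longleftrightarrow> graph_hom \<Gamma> \<Delta> f \<and> f ` verts \<Gamma> = verts \<Delta>"

definition full_graph_hom :: "'v ugraph \<Rightarrow> 'w ugraph \<Rightarrow> ('v \<Rightarrow> 'w) \<Rightarrow> bool" where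
  "full_graph_hom \<Gamma> \<Delta> f \<longleftrightarrow> graph_hom \<Gamma> \<Delta> f \<and> (\<lambda>e. f ` e) ` edges \<Gamma> = edges \<Delta>"

definition full_graph_epi :: "'v ugraph \<Rightarrow> 'w ugraph \<Rightarrow> ('v \<Rightarrow> 'w) \<Rightarrow> bool" where
  "full_graph_epi \<Gamma> \<Delta> f \<longleftrightarrow> graph_epi \<Gamma> \<Delta> f \<and> full_graph_hom \<Gamma> \<Delta> f"

definition graph_iso :: "'v ugraph \<Rightarrow> 'w ugraph \<Rightarrow> ('v \<Rightarrow> 'w) \<Rightarrow> bool" where
  "graph_iso \<Gamma> \<Delta> f \<longleftrightarrow> full_graph_hom \<Gamma> \<Delta> f \<and> bij_betw f (verts \<Gamma>) (verts \<Delta>)"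

definition graph_direct_product :: "'i set \<Rightarrow> ('i \<Rightarrow> 'v ugraph) \<Rightarrow> ('i \<Rightarrow> 'v) ugraph" where
  "graph_direct_product I \<Gamma> =
     \<lparr>verts = (\<Pi>\<^sub>E i\<in>I. verts (\<Gamma> i)),
      edges = {{u, v} | u v. u \<in> (\<Pi>\<^sub>E i\<in>I. verts (\<Gamma> i)) \<and> v \<in> (\<Pi>\<^sub>E i\<in>I. verts (\<Gamma> i)) \<and>
                 (\<forall>i\<in>I. {u i, v i} \<in> edges (\<Gamma> i))}\<rparr>"

definition full_subdirect_product ::
    "'i set \<Rightarrow> ('i \<Rightarrow> 'v ugraph) \<Rightarrow> ('i \<Rightarrow> 'v) ugraph \<Rightarrow> bool" where
  "full_subdirect_product I \<Gamma> \<Delta> \<longleftrightarrow>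
     is_subgraph \<Delta> (graph_direct_product I \<Gamma>) \<and>
     (\<forall>i\<in>I. full_graph_epi \<Delta> (\<Gamma> i) (\<lambda>u. u i))"


section \<open>Normal edge-transitive Cayley graphs\<close>

definition inverse_closed_generating_set :: "('a, 'b) monoid_scheme \<Rightarrow> 'a set \<Rightarrow> bool" where
  "inverse_closed_generating_set G C \<longleftrightarrow>
     C \<noteq> {} \<and> C \<subseteq> carrier G - {\<one>\<^bsub>G\<^esub>} \<and> generate G C = carrier G \<and> (\<forall>c\<in>C. inv\<^bsub>G\<^esub> c \<in> C)"

definition Cay :: "('a, 'b) monoid_scheme \<Rightarrow> 'a set \<Rightarrow> 'a ugraph" where
  "Cay G C =
     \<lparr>verts = carrier G,
      edges = {{g, h} | g h. g \<in> carrier G \<and> h \<in> carrier G \<and> g \<otimes>\<^bsub>G\<^esub> inv\<^bsub>G\<^esub> h \<in> C}\<rparr>"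

definition Aut_pres :: "('a, 'b) monoid_scheme \<Rightarrow> 'a set \<Rightarrow> ('a \<Rightarrow> 'a) set" where
  "Aut_pres G C = {\<sigma> \<in> auto G. \<sigma> ` C = C}"

definition right_translations :: "('a, 'b) monoid_scheme \<Rightarrow> ('a \<Rightarrow> 'a) set" where
  "right_translations G = {\<lambda>h\<in>carrier G. h \<otimes>\<^bsub>G\<^esub> g | g. g \<in> carrier G}"

text \<open>The semidirect product of the right translations by the automorphisms preserving \<open>C\<close>,
  taken as the product of these two subgroups inside the symmetric group on the carrier.\<close>

definition Cay_normal_group :: "('a, 'b) monoid_scheme \<Rightarrow> 'a set \<Rightarrow> ('a \<Rightarrow> 'a) set" where
  "Cay_normal_group G C = right_translations G <#>\<^bsub>BijGroup (carrier G)\<^esub> Aut_pres G C"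

definition normal_edge_transitive :: "('a, 'b) monoid_scheme \<Rightarrow> 'a set \<Rightarrow> bool" where
  "normal_edge_transitive G C \<longleftrightarrow>
     (\<forall>e\<in>edges (Cay G C). \<forall>e'\<in>edges (Cay G C). \<exists>\<phi>\<in>Cay_normal_group G C. \<phi> ` e = e')"


section \<open>Invariant normal subgroups\<close>

definition characteristic_subgroup :: "'a set \<Rightarrow> ('a, 'b) monoid_scheme \<Rightarrow> bool" where
  "characteristic_subgroup H G \<longleftrightarrow> subgroup H G \<and> (\<forall>\<sigma>\<in>auto G. \<sigma> ` H = H)"

definition characteristically_simple :: "('a, 'b) monoid_scheme \<Rightarrow> bool" where
  "characteristically_simple G \<longleftrightarrow>
     group G \<and> (\<forall>H. characteristic_subgroup H G \<longrightarrow> H = carrier G \<or> H = {\<one>\<^bsub>G\<^esub>})"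

definition inv_normals :: "('a, 'b) monoid_scheme \<Rightarrow> 'a set \<Rightarrow> 'a set set" where
  "inv_normals G C = {N. N \<lhd> G \<and> N \<noteq> carrier G \<and> (\<forall>\<sigma>\<in>Aut_pres G C. \<sigma> ` N = N)}"

definition max_inv_normals :: "('a, 'b) monoid_scheme \<Rightarrow> 'a set \<Rightarrow> 'a set set" where
  "max_inv_normals G C =
     {N \<in> inv_normals G C. \<forall>M\<in>inv_normals G C. N \<subseteq> M \<longrightarrow> M = N}"

text \<open>For a nontrivial finite group, the family intersected here is nonempty, since the trivial
  subgroup lies in \<open>inv_normals G C\<close>.\<close>

definition Frattini_rel :: "('a, 'b) monoid_scheme \<Rightarrow> 'a set \<Rightarrow> 'a set" where
  "Frattini_rel G C = \<Inter> (max_inv_normals G C)"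


section \<open>Quotients\<close>

text \<open>The elements of \<open>G Mod N\<close> are the right cosets of \<open>N\<close>, which for normal \<open>N\<close> are also the
  left cosets.\<close>

definition quot_set :: "('a, 'b) monoid_scheme \<Rightarrow> 'a set \<Rightarrow> 'a set \<Rightarrow> 'a set set" where
  "quot_set G C N = {N #>\<^bsub>G\<^esub> c | c. c \<in> C}"

definition quot_Cay :: "('a, 'b) monoid_scheme \<Rightarrow> 'a set \<Rightarrow> 'a set \<Rightarrow> 'a set ugraph" where
  "quot_Cay G C N = Cay (G Mod N) (quot_set G C N)"

text \<open>The map sending a coset of \<open>X\<close> to the tuple of cosets of the \<open>N i\<close> containing it, for
  \<open>X \<subseteq> N i\<close>; it is written without choosing a representative, see the lemma below.\<close>

definition coset_tuple ::
    "('a, 'b) monoid_scheme \<Rightarrow> 'i set \<Rightarrow> ('i \<Rightarrow> 'a set) \<Rightarrow> 'a set \<Rightarrow> 'i \<Rightarrow> 'a set" where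
  "coset_tuple G I N K = (\<lambda>i\<in>I. N i <#>\<^bsub>G\<^esub> K)"

lemma (in group) coset_tuple_coset:
  assumes "\<And>i. i \<in> I \<Longrightarrow> subgroup (N i) G" "subgroup X G" "\<And>i. i \<in> I \<Longrightarrow> X \<subseteq> N i"
    and "g \<in> carrier G"
  shows "coset_tuple G I N (X #> g) = (\<lambda>i\<in>I. N i #> g)"
proof -
  have "N i <#> (X #> g) = N i #> g" if i: "i \<in> I" for i
  proof -
    have N: "subgroup (N i) G" and XN: "X \<subseteq> N i" using assms i by auto
    have "N i <#> X = N i"
    proof
      show "N i <#> X \<subseteq> N i"
        using XN subgroup.m_closed[OF N] by (auto simp: set_mult_def)
      show "N i \<subseteq> N i <#> X"
      proof
        fix x assume x: "x \<in> N i"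
        then have "x = x \<otimes> \<one>" using subgroup.mem_carrier[OF N] by simp
        then show "x \<in> N i <#> X"
          using x subgroup.one_closed[OF assms(2)] unfolding set_mult_def by blast
      qed
    qed
    then show ?thesis
      using setmult_rcos_assoc[of "N i" X g] subgroup.subset[OF N] subgroup.subset[OF assms(2)] assms(4)
      by simp
  qed
  then show ?thesis unfolding coset_tuple_def by (rule restrict_ext)
qed


section \<open>The two decomposition conditions\<close>

definition quotient_decomposition ::
    "('a, 'b) monoid_scheme \<Rightarrow> 'a set \<Rightarrow> 'i set \<Rightarrow> ('i \<Rightarrow> 'a set) \<Rightarrow> bool" where
  "quotient_decomposition G C I N \<longleftrightarrow>
     (let X = (\<Inter>i\<in>I. N i) in
        X \<in> inv_normals G C \<and>
        coset_tuple G I N \<in> iso (G Mod X) (product_group I (\<lambda>i. G Mod N i)))"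

definition Cayley_decomposition ::
    "('a, 'b) monoid_scheme \<Rightarrow> 'a set \<Rightarrow> 'i set \<Rightarrow> ('i \<Rightarrow> 'a set) \<Rightarrow> bool" where
  "Cayley_decomposition G C I N \<longleftrightarrow>
     (let X = (\<Inter>i\<in>I. N i) in
        (\<forall>i\<in>I. finite (carrier (G Mod N i)) \<and> characteristically_simple (G Mod N i) \<and>
           inverse_closed_generating_set (G Mod N i) (quot_set G C (N i)) \<and>
           graph_connected (quot_Cay G C (N i)) \<and>
           normal_edge_transitive (G Mod N i) (quot_set G C (N i))) \<and>
        (\<exists>\<Delta>. full_subdirect_product I (\<lambda>i. quot_Cay G C (N i)) \<Delta> \<and>
           graph_iso (quot_Cay G C X) \<Delta> (coset_tuple G I N)))"

definition decomposing_intersections :: "('a, 'b) monoid_scheme \<Rightarrow> 'a set \<Rightarrow> 'a set set" where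
  "decomposing_intersections G C =
     {X. \<exists>(k::nat) N. 1 \<le> k \<and> (\<forall>i\<in>{1..k}. N i \<in> max_inv_normals G C) \<and>
        X = (\<Inter>i\<in>{1..k}. N i) \<and>
        quotient_decomposition G C {1..k} N \<and> Cayley_decomposition G C {1..k} N}"

end

theory Submission
  imports Defs "HOL-Algebra.SndIsomorphismGrp"
begin

text \<open>Edge-transitivity of \<open>N(G;C)\<close> makes \<open>Aut(G;C)\<close> transitive on the pairs \<open>{c, c\<inverse>}\<close> with
  \<open>c \<in> C\<close>, so a proper invariant normal subgroup cannot meet \<open>C\<close>: all quotient Cayley graphs are
  simple. The edges of a quotient Cayley graph are the images of the edges of \<open>Cay(G;C)\<close>, and
  \<open>N(G;C)\<close> induces maps on the quotient, whence the graph-theoretic claims hold for every finite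
  family in \<open>A\<^sub>m\<^sub>a\<^sub>x(G;C)\<close>. The quotient \<open>G/N\<close> by a maximal \<open>N\<close> is characteristically
  simple because the preimage of a characteristic subgroup is again normal and invariant.

  For the group isomorphism, run through the members of \<open>A\<^sub>m\<^sub>a\<^sub>x(G;C)\<close> and keep \<open>N\<close> only if it
  does not contain the intersection \<open>X\<close> of those kept so far. Then \<open>N X = G\<close> by maximality, so a
  solution of the coset conditions for the earlier members can be corrected by an element of \<open>X\<close>
  to solve the one for \<open>N\<close>. The subgroups kept have intersection \<open>\<Phi>(G;C)\<close>.\<close>

section \<open>Cayley graphs\<close>

text \<open>Put \<open>c = g \<otimes> inv h\<close>. Here \<open>c\<close> and \<open>h\<close>
  vary independently, so the edges pass to quotients factor by factor.\<close>

lemma (in group) edges_Cay: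
  assumes "C \<subseteq> carrier G"
  shows "edges (Cay G C) = {{c \<otimes> h, h} | c h. c \<in> C \<and> h \<in> carrier G}"
proof -
  have "\<exists>c k. {g, h} = {c \<otimes> k, k} \<and> c \<in> C \<and> k \<in> carrier G"
    if "g \<in> carrier G" "h \<in> carrier G" "g \<otimes> inv h \<in> C" for g h
    using that by (intro exI[of _ "g \<otimes> inv h"] exI[of _ h]) (simp add: m_assoc)
  moreover have "\<exists>g k. {c \<otimes> h, h} = {g, k} \<and> g \<in> carrier G \<and> k \<in> carrier G \<and> g \<otimes> inv k \<in> C"
    if "c \<in> C" "h \<in> carrier G" for c h
    using that assms by (intro exI[of _ "c \<otimes> h"] exI[of _ h]) (auto simp: m_assoc)
  ultimately show ?thesis
    unfolding Cay_def by auto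
qed

lemma verts_Cay [simp]: "verts (Cay G C) = carrier G"
  by (simp add: Cay_def)

lemma (in group) edges_CayE:
  assumes "e \<in> edges (Cay G C)" "C \<subseteq> carrier G"
  obtains c h where "c \<in> C" "h \<in> carrier G" "e = {c \<otimes> h, h}"
  using assms by (auto simp: edges_Cay)

lemma (in group) simple_graph_Cay:
  assumes "finite (carrier G)" "C \<subseteq> carrier G - {\<one>}"
  shows "simple_graph (Cay G C)"
proof -
  have "\<exists>u\<in>carrier G. \<exists>v\<in>carrier G. u \<noteq> v \<and> e = {u, v}" if e: "e \<in> edges (Cay G C)" for e
  proof -
    obtain c h where ch: "c \<in> C" "h \<in> carrier G" "e = {c \<otimes> h, h}"
      using edges_CayE[OF e] assms(2) by blast
    then have "c \<in> carrier G" "c \<noteq> \<one>" using assms(2) by auto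
    then have "c \<otimes> h \<noteq> h" using ch by simp
    with ch \<open>c \<in> carrier G\<close> show ?thesis by blast
  qed
  with assms(1) show ?thesis by (simp add: simple_graph_def)
qed

text \<open>A word in the generators that represents \<open>u \<otimes> inv v\<close> spells a walk
  from \<open>u\<close> to \<open>v\<close>. The induction keeps the end point \<open>h\<close>
  arbitrary, because a product \<open>g1 \<otimes> g2\<close> is handled by first walking from
  \<open>g1 \<otimes> (g2 \<otimes> h)\<close> to \<open>g2 \<otimes> h\<close>.\<close>

lemma (in group) graph_connected_Cay:
  assumes "inverse_closed_generating_set G C"
  shows "graph_connected (Cay G C)"
proof -
  let ?R = "{(x, y). {x, y} \<in> edges (Cay G C)}"
  have C: "C \<subseteq> carrier G" "generate G C = carrier G" and invC: "\<And>c. c \<in> C \<Longrightarrow> inv c \<in> C"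
    using assms by (auto simp: inverse_closed_generating_set_def)
  have edge: "(c \<otimes> h, h) \<in> ?R\<^sup>*" if "c \<in> C" "h \<in> carrier G" for c h
    using that C(1) by (intro r_into_rtrancl) (auto simp: edges_Cay)
  have "\<forall>h\<in>carrier G. (g \<otimes> h, h) \<in> ?R\<^sup>*" if "g \<in> generate G C" for g
    using that
  proof (induction rule: generate.induct)
    case one
    show ?case by simp
  next
    case (incl c)
    then show ?case using edge by blast
  next
    case (inv c)
    then show ?case using edge invC by blast
  next
    case (eng g1 g2)
    have g: "g1 \<in> carrier G" "g2 \<in> carrier G" using eng.hyps C(2) by auto
    show ?case
    proof
      fix h assume h: "h \<in> carrier G"
      have "(g1 \<otimes> (g2 \<otimes> h), g2 \<otimes> h) \<in> ?R\<^sup>*" "(g2 \<otimes> h, h) \<in> ?R\<^sup>*"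
        using eng.IH g h by auto
      then show "(g1 \<otimes> g2 \<otimes> h, h) \<in> ?R\<^sup>*"
        using g h by (simp add: m_assoc)
    qed
  qed
  then have "(u, v) \<in> ?R\<^sup>*" if "u \<in> carrier G" "v \<in> carrier G" for u v
    using C(2) that by (metis inv_closed inv_solve_right m_closed)
  then show ?thesis by (simp add: graph_connected_def)
qed

section \<open>Elements of the group N(G;C) and their action on edges\<close>

lemma autoD:
  assumes "\<sigma> \<in> auto G"
  shows "\<sigma> \<in> hom G G" "\<sigma> \<in> Bij (carrier G)" "inj_on \<sigma> (carrier G)" "\<sigma> ` carrier G = carrier G"
  using assms by (auto simp: auto_def Bij_def bij_betw_def)

text \<open>Multiplication in \<open>BijGroup\<close> is composition, so a translation times an
  automorphism applies the automorphism first.\<close>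

lemma (in group) Cay_normal_group_eq:
  "Cay_normal_group G C =
     {\<lambda>x\<in>carrier G. \<sigma> x \<otimes> g | \<sigma> g. \<sigma> \<in> Aut_pres G C \<and> g \<in> carrier G}"
proof -
  have "(\<lambda>h\<in>carrier G. h \<otimes> g) \<otimes>\<^bsub>BijGroup (carrier G)\<^esub> \<sigma> = (\<lambda>x\<in>carrier G. \<sigma> x \<otimes> g)"
    if g: "g \<in> carrier G" and \<sigma>: "\<sigma> \<in> Aut_pres G C" for g \<sigma>
  proof -
    have \<sigma>: "\<sigma> \<in> Bij (carrier G)" using \<sigma> by (auto simp: Aut_pres_def auto_def)
    have "bij_betw (\<lambda>h\<in>carrier G. h \<otimes> g) (carrier G) (carrier G)"
      using g
      by (intro bij_betw_byWitness[where f' = "\<lambda>h. h \<otimes> inv g"]) (auto simp: m_assoc)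
    then have "(\<lambda>h\<in>carrier G. h \<otimes> g) \<in> Bij (carrier G)" by (simp add: Bij_def)
    with \<sigma> show ?thesis
      using Bij_imp_funcset[OF \<sigma>] by (auto simp: BijGroup_def compose_def fun_eq_iff)
  qed
  then show ?thesis
    unfolding Cay_normal_group_def right_translations_def set_mult_def by fastforce
qed

text \<open>Transitivity is applied to the two edges \<open>{c, \<one>}\<close> and
  \<open>{c', \<one>}\<close> at the identity. Since \<open>\<sigma>\<close> fixes
  \<open>\<one>\<close>, the translation part \<open>g\<close> is the image of
  \<open>\<one>\<close>, hence \<open>\<one>\<close> or \<open>c'\<close>; these two cases give the
  two alternatives.\<close>

lemma (in group) normal_edge_transitive_generators:
  assumes "normal_edge_transitive G C" "C \<subseteq> carrier G" "c \<in> C" "c' \<in> C"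
  obtains \<sigma> where "\<sigma> \<in> Aut_pres G C" "\<sigma> c = c' \<or> \<sigma> c = inv c'"
proof -
  have "{d, \<one>} \<in> edges (Cay G C)" if "d \<in> C" for d
  proof -
    have "d \<otimes> \<one> = d" using that assms(2) by auto
    then have "{d, \<one>} = {d \<otimes> \<one>, \<one>}" by simp
    with that show ?thesis unfolding edges_Cay[OF assms(2)] by blast
  qed
  then have "{c, \<one>} \<in> edges (Cay G C)" "{c', \<one>} \<in> edges (Cay G C)"
    using assms by auto
  then obtain \<phi> where "\<phi> \<in> Cay_normal_group G C" "\<phi> ` {c, \<one>} = {c', \<one>}"
    using assms(1) unfolding normal_edge_transitive_def by blast
  then obtain \<sigma> g where \<sigma>: "\<sigma> \<in> Aut_pres G C" and g: "g \<in> carrier G"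
    and im: "{\<sigma> c \<otimes> g, \<sigma> \<one> \<otimes> g} = {c', \<one>}"
    using assms unfolding Cay_normal_group_eq by auto
  have c: "c \<in> carrier G" "c' \<in> carrier G" using assms by auto
  have hom: "\<sigma> \<in> hom G G" using \<sigma> by (simp add: Aut_pres_def autoD)
  have \<sigma>c: "\<sigma> c \<in> carrier G" using hom c(1) by (rule hom_in_carrier)
  have "\<sigma> \<one> = \<one>" using hom hom_one is_group by blast
  then have "\<sigma> c \<otimes> g = c' \<and> g = \<one> \<or> \<sigma> c \<otimes> g = \<one> \<and> g = c'"
    using im g by (auto simp: doubleton_eq_iff)
  then have "\<sigma> c = c' \<or> \<sigma> c = inv c'"
    using \<sigma>c g c inv_equality by (metis r_one)
  with \<sigma> show thesis using that by blast
qed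

section \<open>Quotients by invariant normal subgroups\<close>

lemma inv_normals_normal: "N \<in> inv_normals G C \<Longrightarrow> N \<lhd> G"
  by (simp add: inv_normals_def)

lemma max_inv_normals_inv: "N \<in> max_inv_normals G C \<Longrightarrow> N \<in> inv_normals G C"
  by (simp add: max_inv_normals_def)

text \<open>One generator in \<open>N\<close> drags all of them into \<open>N\<close>:
  \<open>\<sigma>\<close> maps \<open>N\<close> to itself and \<open>N\<close> is closed under
  inverses. Then \<open>N\<close> would be the whole group.\<close>

lemma (in group) generators_avoid_inv_normals:
  assumes gen: "inverse_closed_generating_set G C" and net: "normal_edge_transitive G C"
    and N: "N \<in> inv_normals G C"
  shows "C \<inter> N = {}"
proof (rule ccontr)
  assume "C \<inter> N \<noteq> {}"
  then obtain c where c: "c \<in> C" "c \<in> N" by blast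
  have C: "C \<subseteq> carrier G" "generate G C = carrier G"
    using gen by (auto simp: inverse_closed_generating_set_def)
  have sub: "subgroup N G" using N inv_normals_normal normal_imp_subgroup by blast
  have "c' \<in> N" if c': "c' \<in> C" for c'
  proof -
    obtain \<sigma> where \<sigma>: "\<sigma> \<in> Aut_pres G C" "\<sigma> c = c' \<or> \<sigma> c = inv c'"
      using normal_edge_transitive_generators[OF net C(1) c(1) c'] .
    have "\<sigma> c \<in> N" using N \<sigma>(1) c(2) by (auto simp: inv_normals_def)
    moreover have "c' \<in> carrier G" using c' C by auto
    ultimately show ?thesis using \<sigma>(2) sub
      by (metis inv_inv subgroup.m_inv_closed)
  qed
  then have "generate G C \<subseteq> N" using generate_subgroup_incl sub by blast
  then show False using C N subgroup.subset[OF sub] by (auto simp: inv_normals_def)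
qed

text \<open>Generation and closure under inverses pass along the projection; disjointness from
  \<open>H\<close> is what keeps the trivial coset out.\<close>

lemma (in normal) inverse_closed_generating_set_quot:
  assumes gen: "inverse_closed_generating_set G C" and disj: "C \<inter> H = {}"
  shows "inverse_closed_generating_set (G Mod H) (quot_set G C H)"
proof -
  have C: "C \<noteq> {}" "C \<subseteq> carrier G" "generate G C = carrier G" and invC: "\<And>c. c \<in> C \<Longrightarrow> inv c \<in> C"
    using gen by (auto simp: inverse_closed_generating_set_def)
  have im: "quot_set G C H = (\<lambda>a. H #> a) ` C" by (auto simp: quot_set_def)
  interpret h: group_hom G "G Mod H" "\<lambda>a. H #> a"
    using factorgroup_is_group is_group r_coset_hom_Mod
    by (simp add: group_hom_def group_hom_axioms_def)
  have "generate (G Mod H) (quot_set G C H) = carrier (G Mod H)"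
    using h.generate_img[OF C(2)] C(3) by (simp add: im carrier_FactGroup)
  moreover have "H #> c \<noteq> H" if "c \<in> C" for c
    using coset_join1[of H c] that C(2) disj is_subgroup by blast
  moreover have "inv\<^bsub>G Mod H\<^esub> (H #> c) \<in> quot_set G C H" if "c \<in> C" for c
    using that C(2) invC by (auto simp: im simp flip: h.hom_inv)
  ultimately show ?thesis
    unfolding inverse_closed_generating_set_def using C by (auto simp: im carrier_FactGroup)
qed

text \<open>This reduces later claims about quotient graphs to images of edges of a single graph,
  \<open>Cay G C\<close>.\<close>

lemma (in normal) edges_quot_Cay:
  assumes "C \<subseteq> carrier G"
  shows "edges (quot_Cay G C H) = (\<lambda>e. (\<lambda>g. H #> g) ` e) ` edges (Cay G C)"
proof -
  interpret Q: group "G Mod H" by (rule factorgroup_is_group)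
  have "quot_set G C H \<subseteq> carrier (G Mod H)"
    using assms by (auto simp: quot_set_def carrier_FactGroup)
  then have "edges (quot_Cay G C H) =
      {{(H #> c) <#> (H #> h), H #> h} | c h. c \<in> C \<and> h \<in> carrier G}"
    unfolding quot_Cay_def by (subst Q.edges_Cay) (auto simp: quot_set_def carrier_FactGroup)
  also have "\<dots> = {(\<lambda>g. H #> g) ` {c \<otimes> h, h} | c h. c \<in> C \<and> h \<in> carrier G}"
  proof -
    have "{(H #> c) <#> (H #> h), H #> h} = (\<lambda>g. H #> g) ` {c \<otimes> h, h}"
      if "c \<in> C" "h \<in> carrier G" for c h
      using that assms by (simp add: rcos_sum subset_iff)
    then show ?thesis by (intro Collect_cong) metis
  qed
  also have "\<dots> = (\<lambda>e. (\<lambda>g. H #> g) ` e) ` edges (Cay G C)"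
    unfolding edges_Cay[OF assms] by blast
  finally show ?thesis .
qed

section \<open>Maps induced on the quotient by invariant automorphisms\<close>

lemma (in normal) auto_image_coset:
  assumes "\<sigma> \<in> auto G" "\<sigma> ` H = H" "x \<in> carrier G"
  shows "\<sigma> ` (H #> x) = H #> \<sigma> x"
  using coset_hom(2)[OF autoD(1)[OF assms(1)] subset assms(3)] assms(2) by simp

text \<open>The induced map acts on cosets as sets, by taking images, so no representatives have to
  be chosen. It is restricted to the carrier because members of \<open>auto\<close> must be
  extensional.\<close>

lemma (in normal) induced_auto:
  assumes \<sigma>: "\<sigma> \<in> auto G" and inv: "\<sigma> ` H = H"
  shows "(\<lambda>K\<in>carrier (G Mod H). \<sigma> ` K) \<in> auto (G Mod H)"
proof -
  note coset = auto_image_coset[OF \<sigma> inv]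
  have cl: "\<sigma> x \<in> carrier G" if "x \<in> carrier G" for x
    using that autoD(1)[OF \<sigma>] hom_in_carrier by metis
  have "(\<lambda>K. \<sigma> ` K) ` carrier (G Mod H) = (\<lambda>x. H #> x) ` (\<sigma> ` carrier G)"
    unfolding carrier_FactGroup image_image using coset by (auto simp: image_iff)
  then have surj: "(\<lambda>K. \<sigma> ` K) ` carrier (G Mod H) = carrier (G Mod H)"
    by (simp add: carrier_FactGroup autoD(4)[OF \<sigma>])
  have "K \<subseteq> carrier G" if "K \<in> carrier (G Mod H)" for K
    using that subset by (auto simp: carrier_FactGroup r_coset_def)
  \<comment> \<open>An injective map is also injective on subsets of its domain.\<close>
  then have "inj_on (\<lambda>K. \<sigma> ` K) (carrier (G Mod H))"
    using autoD(3)[OF \<sigma>] by (intro inj_onI) (meson inj_on_image_eq_iff)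
  with surj have bij: "bij_betw (\<lambda>K. \<sigma> ` K) (carrier (G Mod H)) (carrier (G Mod H))"
    by (simp add: bij_betw_def)
  have mult: "\<sigma> ` (K <#> L) = \<sigma> ` K <#> \<sigma> ` L"
    if "K \<subseteq> carrier G" "L \<subseteq> carrier G" for K L
    using set_mult_hom[OF autoD(1)[OF \<sigma>]] that by blast
  interpret Q: group "G Mod H" by (rule factorgroup_is_group)
  have "(\<lambda>K\<in>carrier (G Mod H). \<sigma> ` K) \<in> hom (G Mod H) (G Mod H)"
  proof (rule homI)
    fix K L assume KL: "K \<in> carrier (G Mod H)" "L \<in> carrier (G Mod H)"
    then show "(\<lambda>K\<in>carrier (G Mod H). \<sigma> ` K) (K \<otimes>\<^bsub>G Mod H\<^esub> L) =
        (\<lambda>K\<in>carrier (G Mod H). \<sigma> ` K) K \<otimes>\<^bsub>G Mod H\<^esub> (\<lambda>K\<in>carrier (G Mod H). \<sigma> ` K) L"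
      using Q.m_closed[OF KL] mult \<open>\<And>K. K \<in> carrier (G Mod H) \<Longrightarrow> K \<subseteq> carrier G\<close> by simp
  qed (use surj in auto)
  with bij show ?thesis
    by (simp add: auto_def Bij_def)
qed

text \<open>Two edges of the quotient graph are lifted to \<open>Cay G C\<close>, joined there by
  some \<open>\<phi>\<close>, and \<open>\<phi>\<close> is pushed down to the quotient.\<close>

lemma (in normal) normal_edge_transitive_quot:
  assumes C: "C \<subseteq> carrier G" and net: "normal_edge_transitive G C"
    and inv: "\<And>\<sigma>. \<sigma> \<in> Aut_pres G C \<Longrightarrow> \<sigma> ` H = H"
  shows "normal_edge_transitive (G Mod H) (quot_set G C H)"
  unfolding normal_edge_transitive_def
proof (intro ballI)
  interpret Q: group "G Mod H" by (rule factorgroup_is_group)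
  fix e e'
  assume "e \<in> edges (Cay (G Mod H) (quot_set G C H))" "e' \<in> edges (Cay (G Mod H) (quot_set G C H))"
  then obtain d d' where d: "d \<in> edges (Cay G C)" "e = (\<lambda>g. H #> g) ` d"
    and d': "d' \<in> edges (Cay G C)" "e' = (\<lambda>g. H #> g) ` d'"
    using edges_quot_Cay[OF C] unfolding quot_Cay_def by auto
  obtain \<phi> where \<phi>: "\<phi> \<in> Cay_normal_group G C" "\<phi> ` d = d'"
    using net d d' unfolding normal_edge_transitive_def by blast
  then obtain \<sigma> g where \<sigma>: "\<sigma> \<in> Aut_pres G C" and g: "g \<in> carrier G"
    and \<phi>_eq: "\<phi> = (\<lambda>x\<in>carrier G. \<sigma> x \<otimes> g)"
    unfolding Cay_normal_group_eq by blast
  have \<sigma>': "\<sigma> \<in> auto G" "\<sigma> ` C = C" using \<sigma> by (auto simp: Aut_pres_def)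
  note coset = auto_image_coset[OF \<sigma>'(1) inv[OF \<sigma>]]
  define \<tau> where "\<tau> = (\<lambda>K\<in>carrier (G Mod H). \<sigma> ` K)"
  have \<tau>_coset: "\<tau> (H #> x) = H #> \<sigma> x" if "x \<in> carrier G" for x
    using that coset by (auto simp: \<tau>_def carrier_FactGroup)
  have "\<tau> ` quot_set G C H = (\<lambda>c. H #> c) ` (\<sigma> ` C)"
  proof -
    have "\<tau> ` quot_set G C H = (\<lambda>c. \<tau> (H #> c)) ` C"
      by (auto simp: quot_set_def)
    also have "\<dots> = (\<lambda>c. H #> c) ` (\<sigma> ` C)"
      unfolding image_image using C \<tau>_coset by (intro image_cong) auto
    finally show ?thesis .
  qed
  then have "\<tau> ` quot_set G C H = quot_set G C H"
    using \<sigma>'(2) by (auto simp: quot_set_def)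
  moreover have "\<tau> \<in> auto (G Mod H)"
    unfolding \<tau>_def by (rule induced_auto[OF \<sigma>'(1) inv[OF \<sigma>]])
  ultimately have \<tau>: "\<tau> \<in> Aut_pres (G Mod H) (quot_set G C H)"
    by (simp add: Aut_pres_def)
  \<comment> \<open>This is the map that \<open>\<phi>\<close> induces on cosets, written in the
    form that \<open>Q.Cay_normal_group_eq\<close> requires.\<close>
  define \<psi> where "\<psi> = (\<lambda>K\<in>carrier (G Mod H). \<tau> K <#> (H #> g))"
  have \<psi>_coset: "\<psi> (H #> x) = H #> \<phi> x" if x: "x \<in> carrier G" for x
  proof -
    have "\<sigma> x \<in> carrier G" using x autoD(1)[OF \<sigma>'(1)] hom_in_carrier by metis
    then show ?thesis
      using x g by (simp add: \<psi>_def \<phi>_eq \<tau>_coset rcos_sum carrier_FactGroup)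
  qed
  have "d \<subseteq> carrier G" using d(1) by (auto simp: Cay_def)
  then have "\<psi> ` e = e'"
    unfolding d(2) d'(2) \<phi>(2)[symmetric] image_image using \<psi>_coset by (intro image_cong) auto
  moreover have "\<psi> \<in> Cay_normal_group (G Mod H) (quot_set G C H)"
    unfolding Q.Cay_normal_group_eq \<psi>_def using \<tau> g by (auto simp: carrier_FactGroup)
  ultimately show "\<exists>\<psi>\<in>Cay_normal_group (G Mod H) (quot_set G C H). \<psi> ` e = e'"
    by blast
qed

section \<open>Characteristic simplicity of the quotients\<close>

lemma (in group) characteristic_imp_normal:
  assumes "characteristic_subgroup H G"
  shows "H \<lhd> G"
proof (rule normal_invI)
  show "subgroup H G" using assms by (simp add: characteristic_subgroup_def)
next
  fix x h assume x: "x \<in> carrier G" and h: "h \<in> H"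
  have sub: "H \<subseteq> carrier G" using assms by (simp add: characteristic_subgroup_def subgroup.subset)
  \<comment> \<open>Conjugation by \<open>x\<close>, made extensional so that it belongs to
    \<open>auto G\<close>.\<close>
  define \<sigma> where "\<sigma> = (\<lambda>y\<in>carrier G. x \<otimes> y \<otimes> inv x)"
  have "\<sigma> \<in> hom G G"
    using x by (auto simp: \<sigma>_def hom_def m_assoc simp flip: m_assoc[of x "inv x"] m_assoc[of "inv x" x])
  moreover have "bij_betw \<sigma> (carrier G) (carrier G)"
    using x by (intro bij_betw_byWitness[where f' = "\<lambda>y. inv x \<otimes> y \<otimes> x"])
      (auto simp: \<sigma>_def m_assoc simp flip: m_assoc[of x "inv x"] m_assoc[of "inv x" x])
  ultimately have "\<sigma> \<in> auto G" by (auto simp: auto_def Bij_def \<sigma>_def)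
  then have "\<sigma> h \<in> H" using assms h by (auto simp: characteristic_subgroup_def)
  then show "x \<otimes> h \<otimes> inv x \<in> H" using h sub by (auto simp: \<sigma>_def)
qed

text \<open>By the correspondence between subgroups of \<open>G Mod N\<close> and subgroups of
  \<open>G\<close> above \<open>N\<close>: the preimage of \<open>A\<close> is the union
  \<open>\<Union>A\<close> of its cosets, and maximality of \<open>N\<close> leaves only the two
  extreme values for it.\<close>

lemma (in group) characteristically_simple_quot:
  assumes N: "N \<in> max_inv_normals G C"
  shows "characteristically_simple (G Mod N)"
proof -
  have Ni: "N \<in> inv_normals G C" using N by (rule max_inv_normals_inv)
  interpret N: normal N G using Ni by (rule inv_normals_normal)
  interpret Q: group "G Mod N" by (rule N.factorgroup_is_group)
  have "A = carrier (G Mod N) \<or> A = {N}" if A: "characteristic_subgroup A (G Mod N)" for A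
  proof -
    have An: "A \<lhd> G Mod N" using A by (rule Q.characteristic_imp_normal)
    have As: "subgroup A (G Mod N)" using A by (simp add: characteristic_subgroup_def)
    have mem: "\<Union>A = {x \<in> carrier G. N #> x \<in> A}"
      using N.factgroup_subgroup_union_char[OF As] .
    have "\<sigma> ` \<Union>A = \<Union>A" if \<sigma>: "\<sigma> \<in> Aut_pres G C" for \<sigma>
    proof -
      have "(\<lambda>K\<in>carrier (G Mod N). \<sigma> ` K) \<in> auto (G Mod N)"
        using \<sigma> Ni by (intro N.induced_auto) (auto simp: Aut_pres_def inv_normals_def)
      then have "(\<lambda>K\<in>carrier (G Mod N). \<sigma> ` K) ` A = A"
        using A unfolding characteristic_subgroup_def by blast
      moreover have "(\<lambda>K\<in>carrier (G Mod N). \<sigma> ` K) ` A = (\<lambda>K. \<sigma> ` K) ` A"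
        using subgroup.subset[OF As] by (intro image_cong) auto
      ultimately show ?thesis by (simp add: image_Union)
    qed
    moreover have "\<Union>A \<lhd> G" using N.factgroup_subgroup_union_normal[OF An] .
    ultimately have "\<Union>A = carrier G \<or> \<Union>A \<in> inv_normals G C"
      by (auto simp: inv_normals_def)
    \<comment> \<open>\<open>N\<close> is the identity of \<open>G Mod N\<close>, hence an element
      of \<open>A\<close>.\<close>
    moreover have "N \<subseteq> \<Union>A" using subgroup.one_closed[OF As] by auto
    ultimately have "\<Union>A = carrier G \<or> \<Union>A = N"
      using N by (auto simp: max_inv_normals_def)
    then show ?thesis
    proof
      assume "\<Union>A = carrier G"
      then have "carrier (G Mod N) \<subseteq> A" using mem by (auto simp: carrier_FactGroup)
      then show ?thesis using subgroup.subset[OF As] by blast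
    next
      assume "\<Union>A = N"
      have A_triv: "K = N" if K: "K \<in> A" for K
      proof -
        obtain x where x: "x \<in> carrier G" "K = N #> x"
          using K subgroup.subset[OF As] by (auto simp: carrier_FactGroup)
        then have "x \<in> N" using mem K \<open>\<Union>A = N\<close> by auto
        then show ?thesis using x coset_join2 N.is_subgroup by simp
      qed
      have "N \<in> A" using subgroup.one_closed[OF As] by simp
      with A_triv have "A = {N}" by blast
      then show ?thesis ..
    qed
  qed
  then show ?thesis
    using Q.is_group by (simp add: characteristically_simple_def)
qed

section \<open>Intersections of invariant normal subgroups\<close>

lemma (in group) INT_inv_normals:
  assumes "I \<noteq> {}" "\<And>i. i \<in> I \<Longrightarrow> N i \<in> inv_normals G C"
  shows "(\<Inter>i\<in>I. N i) \<in> inv_normals G C"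
proof -
  let ?X = "\<Inter>i\<in>I. N i"
  have nor: "N i \<lhd> G" if "i \<in> I" for i using assms(2) that by (simp add: inv_normals_def)
  have sub: "N i \<subseteq> carrier G" if "i \<in> I" for i
    using nor that normal_imp_subgroup subgroup.subset by blast
  have "subgroup ?X G"
    using assms(1) nor by (intro subgroups_Inter) (auto intro: normal_imp_subgroup)
  then have "?X \<lhd> G"
    using nor by (intro normal_invI) (auto simp: normal.inv_op_closed2)
  moreover have "?X \<noteq> carrier G"
  proof
    assume X: "?X = carrier G"
    obtain i where i: "i \<in> I" using assms(1) by blast
    then have "carrier G \<subseteq> N i" using X by blast
    then show False using i sub assms(2)[OF i] by (auto simp: inv_normals_def)
  qed
  moreover have "\<sigma> ` ?X = ?X" if \<sigma>: "\<sigma> \<in> Aut_pres G C" for \<sigma>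
  proof -
    \<comment> \<open>Injectivity is what lets the image commute with the intersection.\<close>
    have "inj_on \<sigma> (carrier G)" using \<sigma> by (simp add: Aut_pres_def autoD)
    then have "\<sigma> ` ?X = (\<Inter>i\<in>I. \<sigma> ` N i)"
      using assms(1) sub by (metis image_INT ex_in_conv)
    also have "\<dots> = ?X"
      using assms(2) \<sigma> by (intro INF_cong) (auto simp: inv_normals_def)
    finally show ?thesis .
  qed
  ultimately show ?thesis by (simp add: inv_normals_def)
qed

text \<open>The product of two invariant normal subgroups is again normal and invariant. If it were
  proper, maximality would make it equal to \<open>N\<close>, and then
  \<open>X \<subseteq> N\<close>.\<close>

lemma (in group) set_mult_max_inv_normals:
  assumes N: "N \<in> max_inv_normals G C" and X: "X \<in> inv_normals G C" and "\<not> X \<subseteq> N"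
  shows "N <#> X = carrier G"
proof (rule ccontr)
  assume ne: "N <#> X \<noteq> carrier G"
  have Ni: "N \<in> inv_normals G C" using N by (rule max_inv_normals_inv)
  have nor: "N \<lhd> G" "X \<lhd> G" using Ni X by (auto simp: inv_normals_def)
  have s: "subgroup N G" "subgroup X G" using nor normal_imp_subgroup by auto
  have sub: "N \<subseteq> carrier G" "X \<subseteq> carrier G" using s subgroup.subset by auto
  have "N <#> X \<lhd> G" using nor by (rule normal_subgroup_set_mult_closed)
  moreover have "\<sigma> ` (N <#> X) = N <#> X" if \<sigma>: "\<sigma> \<in> Aut_pres G C" for \<sigma>
    using set_mult_hom[of \<sigma> G G N X] sub \<sigma> Ni X
    by (simp add: Aut_pres_def autoD inv_normals_def)
  ultimately have "N <#> X \<in> inv_normals G C" using ne by (simp add: inv_normals_def)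
  moreover have "N \<subseteq> N <#> X"
    using subgroup.one_closed[OF s(2)] sub by (force simp: set_mult_def)
  ultimately have "N <#> X = N" using N by (simp add: max_inv_normals_def)
  moreover have "X \<subseteq> N <#> X"
    using subgroup.one_closed[OF s(1)] sub by (force simp: set_mult_def)
  ultimately show False using assms(3) by simp
qed

text \<open>This is surjectivity of \<open>G \<rightarrow> \<Prod> G/N\<close>, phrased with representatives.\<close>

definition (in group) coset_independent :: "'a set set \<Rightarrow> bool" where
  "coset_independent S \<longleftrightarrow>
     (\<forall>g. (\<forall>N\<in>S. g N \<in> carrier G) \<longrightarrow> (\<exists>h\<in>carrier G. \<forall>N\<in>S. N #> h = N #> g N))"

text \<open>A Chinese remainder step. If \<open>h\<close> solves the conditions for
  \<open>S\<close>, so does \<open>x \<otimes> h\<close> for every \<open>x \<in> \<Inter>S\<close>;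
  it remains to choose \<open>x\<close> so that the condition for \<open>N\<close> holds as
  well.\<close>

lemma (in group) coset_independent_insert:
  assumes ind: "coset_independent S" and S: "S \<noteq> {}" "S \<subseteq> inv_normals G C"
    and N: "N \<in> max_inv_normals G C" and nsub: "\<not> \<Inter>S \<subseteq> N"
  shows "coset_independent (insert N S)"
  unfolding coset_independent_def
proof (intro allI impI)
  fix g assume g: "\<forall>M\<in>insert N S. g M \<in> carrier G"
  then obtain h where h: "h \<in> carrier G" "\<forall>M\<in>S. M #> h = M #> g M"
    using ind unfolding coset_independent_def by blast
  have X: "\<Inter>S \<in> inv_normals G C"
    using INT_inv_normals[of S "\<lambda>M. M"] S by auto
  have sub: "subgroup M G" if "M \<in> insert N S" for M
    using that S(2) N by (auto intro: normal_imp_subgroup simp: inv_normals_def max_inv_normals_def)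
  have "N <#> \<Inter>S = carrier G"
    using set_mult_max_inv_normals[OF N X nsub] .
  moreover have "g N \<otimes> inv h \<in> carrier G" using g h by simp
  ultimately have "g N \<otimes> inv h \<in> N <#> \<Inter>S" by simp
  \<comment> \<open>The factor \<open>x\<close> is the required correction, and \<open>n\<close> is
    absorbed by \<open>N\<close>.\<close>
  then obtain n x where nx: "n \<in> N" "x \<in> \<Inter>S" "g N \<otimes> inv h = n \<otimes> x"
    unfolding set_mult_def by blast
  have "subgroup (\<Inter>S) G" using X inv_normals_normal normal_imp_subgroup by blast
  then have c: "n \<in> carrier G" "x \<in> carrier G"
    using subgroup.mem_carrier[OF sub[OF insertI1] nx(1)] subgroup.mem_carrier[OF _ nx(2)] by simp_all
  have gN: "g N \<in> carrier G" using g by simp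
  have "g N = g N \<otimes> inv h \<otimes> h" using gN h(1) by (simp add: m_assoc)
  then have "g N = n \<otimes> (x \<otimes> h)" using nx(3) c h(1) by (simp add: m_assoc)
  have "M #> (x \<otimes> h) = M #> g M" if M: "M \<in> S" for M
  proof -
    have "x \<in> M" using nx(2) M by blast
    then have "M #> x = M" using coset_join2 c(2) sub M by blast
    then show ?thesis
      using h M c sub[of M] by (metis coset_mult_assoc insertCI subgroup.subset)
  qed
  moreover have "N #> (x \<otimes> h) = N #> g N"
  proof -
    have "N #> n = N" using coset_join2 c(1) sub nx(1) by blast
    then show ?thesis
      using \<open>g N = n \<otimes> (x \<otimes> h)\<close> h(1) c sub[of N]
      by (metis coset_mult_assoc insertCI m_closed subgroup.subset)
  qed
  ultimately show "\<exists>h\<in>carrier G. \<forall>M\<in>insert N S. M #> h = M #> g M"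
    using c(2) h(1) by (intro bexI[of _ "x \<otimes> h"]) auto
qed

text \<open>A greedy choice: a new member that contains the current intersection is dropped, which
  leaves the intersection unchanged; any other one is kept.\<close>

lemma (in group) ex_coset_independent_subfamily:
  assumes "finite F" "F \<noteq> {}" "F \<subseteq> max_inv_normals G C"
  shows "\<exists>S\<subseteq>F. S \<noteq> {} \<and> \<Inter>S = \<Inter>F \<and> coset_independent S"
  using assms
proof (induction rule: finite_ne_induct)
  case (singleton N)
  have "coset_independent {N}" by (auto simp: coset_independent_def)
  then show ?case by blast
next
  case (insert N F)
  then obtain S where S: "S \<subseteq> F" "S \<noteq> {}" "\<Inter>S = \<Inter>F" "coset_independent S"
    by auto
  show ?case
  proof (cases "\<Inter>S \<subseteq> N")
    case True
    then have "\<Inter>S = \<Inter>(insert N F)" using S(3) by auto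
    then show ?thesis using S by blast
  next
    case False
    have "coset_independent (insert N S)"
      using insert.prems S False
      by (intro coset_independent_insert[of S C]) (auto simp: max_inv_normals_def)
    then show ?thesis using S by (intro exI[of _ "insert N S"]) auto
  qed
qed

section \<open>The decompositions\<close>

text \<open>Elements \<open>a\<close> and \<open>b\<close> with equal tuples have
  \<open>a \<otimes> inv b\<close> in every \<open>N i\<close>, hence in the intersection.\<close>

lemma (in group) inj_on_coset_tuple:
  assumes nor: "\<And>i. i \<in> I \<Longrightarrow> N i \<lhd> G" and X: "(\<Inter>i\<in>I. N i) \<lhd> G"
  shows "inj_on (coset_tuple G I N) (carrier (G Mod (\<Inter>i\<in>I. N i)))"
proof (rule inj_onI)
  let ?X = "\<Inter>i\<in>I. N i"
  fix K L assume KL: "K \<in> carrier (G Mod ?X)" "L \<in> carrier (G Mod ?X)"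
    and eq: "coset_tuple G I N K = coset_tuple G I N L"
  obtain a b where ab: "a \<in> carrier G" "b \<in> carrier G" "K = ?X #> a" "L = ?X #> b"
    using KL by (auto simp: carrier_FactGroup)
  have sub: "subgroup (N i) G" if "i \<in> I" for i using nor that by (simp add: normal_imp_subgroup)
  have Xs: "subgroup ?X G" using X by (rule normal_imp_subgroup)
  have tuple: "coset_tuple G I N (?X #> g) = (\<lambda>i\<in>I. N i #> g)" if "g \<in> carrier G" for g
    using that sub Xs by (intro coset_tuple_coset) auto
  have "a \<otimes> inv b \<in> N i" if i: "i \<in> I" for i
  proof -
    have "N i #> a = N i #> b"
      using fun_cong[OF eq, of i] ab i by (simp add: tuple)
    then show ?thesis
      using ab rcos_self[OF ab(1) sub[OF i]] subgroup.rcos_module_imp[OF sub[OF i] is_group] by simp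
  qed
  then have "a \<in> ?X #> b"
    using ab by (intro subgroup.rcos_module_rev[OF Xs is_group]) auto
  then show "K = L" using ab repr_independence Xs by metis
qed

text \<open>Surjectivity is the independence hypothesis. That hypothesis labels coset conditions by
  subgroups and not by indices, so \<open>N\<close> is assumed injective: a repeated subgroup could
  be given two conflicting cosets.\<close>

lemma (in group) quotient_decomposition_coset_independent:
  assumes N: "\<And>i. i \<in> I \<Longrightarrow> N i \<in> inv_normals G C" and ne: "I \<noteq> {}"
    and inj: "inj_on N I" and ind: "coset_independent (N ` I)"
  shows "quotient_decomposition G C I N"
proof -
  let ?X = "\<Inter>i\<in>I. N i"
  have nor: "N i \<lhd> G" if "i \<in> I" for i using N[OF that] by (rule inv_normals_normal)
  have sub: "subgroup (N i) G" if "i \<in> I" for i using nor that by (simp add: normal_imp_subgroup)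
  have X: "?X \<in> inv_normals G C" using INT_inv_normals[OF ne N] .
  then interpret X: normal ?X G by (rule inv_normals_normal)
  have tuple: "coset_tuple G I N (?X #> g) = (\<lambda>i\<in>I. N i #> g)" if "g \<in> carrier G" for g
    using that sub X.is_subgroup by (intro coset_tuple_coset) auto
  let ?P = "product_group I (\<lambda>i. G Mod N i)"
  have hom: "coset_tuple G I N \<in> hom (G Mod ?X) ?P"
  proof (rule homI)
    fix K assume "K \<in> carrier (G Mod ?X)"
    then show "coset_tuple G I N K \<in> carrier ?P"
      by (auto simp: carrier_FactGroup tuple)
  next
    fix K L assume "K \<in> carrier (G Mod ?X)" "L \<in> carrier (G Mod ?X)"
    then obtain a b where ab: "a \<in> carrier G" "b \<in> carrier G" "K = ?X #> a" "L = ?X #> b"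
      by (auto simp: carrier_FactGroup)
    then have "coset_tuple G I N (K <#> L) = (\<lambda>i\<in>I. N i #> (a \<otimes> b))"
      by (simp add: X.rcos_sum tuple)
    also have "\<dots> = (\<lambda>i\<in>I. (N i #> a) <#> (N i #> b))"
      using ab normal.rcos_sum[OF nor] by (intro restrict_ext) simp
    finally show "coset_tuple G I N (K \<otimes>\<^bsub>G Mod ?X\<^esub> L) =
        coset_tuple G I N K \<otimes>\<^bsub>?P\<^esub> coset_tuple G I N L"
      using ab by (simp add: tuple cong: restrict_cong)
  qed
  have "carrier ?P \<subseteq> coset_tuple G I N ` carrier (G Mod ?X)"
  proof
    fix f assume f: "f \<in> carrier ?P"
    then have "\<forall>i\<in>I. \<exists>x\<in>carrier G. f i = N i #> x"
      by (auto simp: PiE_iff carrier_FactGroup)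
    then obtain r where r: "\<And>i. i \<in> I \<Longrightarrow> r i \<in> carrier G \<and> f i = N i #> r i"
      by metis
    \<comment> \<open>The representatives \<open>r\<close>, indexed by \<open>I\<close>, are
      reindexed by the subgroups themselves.\<close>
    have "\<forall>M\<in>N ` I. r (inv_into I N M) \<in> carrier G"
      using inj r by simp
    then obtain h where h: "h \<in> carrier G" "\<forall>M\<in>N ` I. M #> h = M #> r (inv_into I N M)"
      using ind[unfolded coset_independent_def, rule_format, of "\<lambda>M. r (inv_into I N M)"] by auto
    have "f = (\<lambda>i\<in>I. N i #> h)"
      using f r h inj by (auto simp: fun_eq_iff PiE_iff extensional_def)
    then have "f = coset_tuple G I N (?X #> h)" using tuple h(1) by simp
    moreover have "?X #> h \<in> carrier (G Mod ?X)" using h(1) by (simp add: carrier_FactGroup)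
    ultimately show "f \<in> coset_tuple G I N ` carrier (G Mod ?X)" by blast
  qed
  with hom have "bij_betw (coset_tuple G I N) (carrier (G Mod ?X)) (carrier ?P)"
    using inj_on_coset_tuple[OF nor X.normal_axioms] by (auto simp: bij_betw_def hom_def)
  with hom have "coset_tuple G I N \<in> iso (G Mod ?X) ?P" by (simp add: iso_def)
  with X show ?thesis by (simp add: quotient_decomposition_def)
qed

section \<open>Quotient graphs and subdirect products\<close>

lemma verts_quot_Cay: "verts (quot_Cay G C N) = carrier (G Mod N)"
  by (simp add: quot_Cay_def)

lemma finite_carrier_FactGroup: "finite (carrier G) \<Longrightarrow> finite (carrier (G Mod N))"
  by (simp add: carrier_FactGroup)

lemma simple_graph_quot_Cay:
  assumes "N \<lhd> G" "finite (carrier G)" "inverse_closed_generating_set (G Mod N) (quot_set G C N)"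
  shows "simple_graph (quot_Cay G C N)"
proof -
  interpret group "G Mod N" using assms(1) by (rule normal.factorgroup_is_group)
  show ?thesis
    unfolding quot_Cay_def using assms
    by (intro simple_graph_Cay)
      (auto simp: inverse_closed_generating_set_def intro: finite_carrier_FactGroup)
qed

text \<open>A loop in the product would project to a loop in a factor. Over an empty index set the
  single vertex would carry a loop, hence \<open>I \<noteq> {}\<close>.\<close>

lemma simple_graph_direct_product:
  assumes "finite I" "I \<noteq> {}" "\<And>i. i \<in> I \<Longrightarrow> simple_graph (\<Gamma> i)"
  shows "simple_graph (graph_direct_product I \<Gamma>)"
proof -
  have "finite (\<Pi>\<^sub>E i\<in>I. verts (\<Gamma> i))"
    using assms by (intro finite_PiE) (auto simp: simple_graph_def)
  moreover have "u \<noteq> v" if uv: "\<forall>i\<in>I. {u i, v i} \<in> edges (\<Gamma> i)" for u v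
  proof -
    obtain i where "i \<in> I" using assms(2) by blast
    then have "u i \<noteq> v i"
      using uv assms(3)[of i] unfolding simple_graph_def by (fastforce simp: doubleton_eq_iff)
    then show ?thesis by auto
  qed
  ultimately show ?thesis
    unfolding simple_graph_def graph_direct_product_def by auto
qed

text \<open>The quotient by the intersection, the graph \<open>\<Delta>\<close> and all factors are
  images of \<open>Cay G C\<close> on vertices and on edges, under compatible maps. So the
  isomorphism and the projections are full and onto for formal reasons.\<close>

lemma (in group) Cayley_graph_subdirect:
  assumes fin: "finite (carrier G)" and I: "finite I" "I \<noteq> {}" and C: "C \<subseteq> carrier G"
    and nor: "\<And>i. i \<in> I \<Longrightarrow> N i \<lhd> G" and X: "(\<Inter>i\<in>I. N i) \<lhd> G"
    and simple: "\<And>i. i \<in> I \<Longrightarrow> simple_graph (quot_Cay G C (N i))"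
      "simple_graph (quot_Cay G C (\<Inter>i\<in>I. N i))"
  shows "\<exists>\<Delta>. full_subdirect_product I (\<lambda>i. quot_Cay G C (N i)) \<Delta> \<and>
           graph_iso (quot_Cay G C (\<Inter>i\<in>I. N i)) \<Delta> (coset_tuple G I N)"
proof -
  let ?X = "\<Inter>i\<in>I. N i" and ?Z = "coset_tuple G I N" and ?E = "edges (Cay G C)"
  let ?\<Gamma> = "\<lambda>i. quot_Cay G C (N i)"
  define z where "z = (\<lambda>g. \<lambda>i\<in>I. N i #> g)"
  interpret X: normal ?X G by (rule X)
  have sub: "subgroup (N i) G" if "i \<in> I" for i using nor that by (simp add: normal_imp_subgroup)
  have tuple: "?Z (?X #> g) = z g" if "g \<in> carrier G" for g
    unfolding z_def using that sub X.is_subgroup by (intro coset_tuple_coset) auto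
  have Esub: "e \<subseteq> carrier G" if "e \<in> ?E" for e using that by (auto simp: Cay_def)
  \<comment> \<open>The witness is the image of \<open>Cay G C\<close> under \<open>z\<close>, which
    in general has fewer edges than the subgraph of the product induced on the same
    vertices.\<close>
  define \<Delta> where "\<Delta> = \<lparr>verts = z ` carrier G, edges = (\<lambda>e. z ` e) ` ?E\<rparr>"
  have Zim: "?Z ` ((\<lambda>g. ?X #> g) ` e) = z ` e" if "e \<subseteq> carrier G" for e
    unfolding image_image using that tuple by (intro image_cong) auto
  have Zverts: "?Z ` verts (quot_Cay G C ?X) = verts \<Delta>"
    unfolding verts_quot_Cay carrier_FactGroup using Zim[of "carrier G"] by (simp add: \<Delta>_def)
  have Zedges: "(\<lambda>e. ?Z ` e) ` edges (quot_Cay G C ?X) = edges \<Delta>"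
    unfolding X.edges_quot_Cay[OF C] \<Delta>_def using Zim[OF Esub]
    by (simp add: image_image cong: image_cong)
  have pim: "(\<lambda>u. u i) ` (z ` e) = (\<lambda>g. N i #> g) ` e" if "i \<in> I" for i e
    using that by (simp add: z_def image_image)
  have pverts: "(\<lambda>u. u i) ` verts \<Delta> = verts (?\<Gamma> i)" if "i \<in> I" for i
    using pim[OF that] by (simp add: \<Delta>_def verts_quot_Cay carrier_FactGroup)
  have pedges: "(\<lambda>e. (\<lambda>u. u i) ` e) ` edges \<Delta> = edges (?\<Gamma> i)" if "i \<in> I" for i
    unfolding normal.edges_quot_Cay[OF nor[OF that] C]
    by (simp add: \<Delta>_def image_image[of _ "\<lambda>e. z ` e"] pim[OF that])
  have vsub: "verts \<Delta> \<subseteq> verts (graph_direct_product I ?\<Gamma>)"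
    by (auto simp: \<Delta>_def graph_direct_product_def z_def verts_quot_Cay carrier_FactGroup)
  have esub: "edges \<Delta> \<subseteq> edges (graph_direct_product I ?\<Gamma>)"
  proof
    fix e assume e: "e \<in> edges \<Delta>"
    then obtain d where d: "d \<in> ?E" "e = z ` d" by (auto simp: \<Delta>_def)
    then obtain g h where gh: "g \<in> carrier G" "h \<in> carrier G" "d = {g, h}"
      by (auto simp: Cay_def)
    have "{z g i, z h i} \<in> edges (?\<Gamma> i)" if i: "i \<in> I" for i
    proof -
      have "(\<lambda>u. u i) ` e \<in> edges (?\<Gamma> i)" using pedges[OF i] e by blast
      then show ?thesis using d gh by simp
    qed
    moreover have "z g \<in> (\<Pi>\<^sub>E i\<in>I. verts (?\<Gamma> i))" "z h \<in> (\<Pi>\<^sub>E i\<in>I. verts (?\<Gamma> i))"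
      using gh by (auto simp: z_def verts_quot_Cay carrier_FactGroup)
    ultimately show "e \<in> edges (graph_direct_product I ?\<Gamma>)"
      using d gh unfolding graph_direct_product_def by auto
  qed
  have sP: "simple_graph (graph_direct_product I ?\<Gamma>)"
    using simple_graph_direct_product[OF I simple(1)] .
  have s\<Delta>: "simple_graph \<Delta>"
    unfolding simple_graph_def
  proof (intro conjI ballI)
    show "finite (verts \<Delta>)" using fin by (simp add: \<Delta>_def)
    fix e assume e: "e \<in> edges \<Delta>"
    then obtain g h where gh: "g \<in> carrier G" "h \<in> carrier G" "e = {z g, z h}"
      by (auto simp: \<Delta>_def Cay_def)
    \<comment> \<open>The edge \<open>e\<close> also lies in the direct product, which is already
      known to have no loops.\<close>
    moreover have "z g \<noteq> z h"
      using e esub sP gh(3) unfolding simple_graph_def by (fastforce simp: doubleton_eq_iff)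
    ultimately show "\<exists>u\<in>verts \<Delta>. \<exists>v\<in>verts \<Delta>. u \<noteq> v \<and> e = {u, v}"
      by (auto simp: \<Delta>_def)
  qed
  have "graph_iso (quot_Cay G C ?X) \<Delta> ?Z"
    unfolding graph_iso_def full_graph_hom_def graph_hom_def bij_betw_def
    using simple(2) s\<Delta> Zverts Zedges inj_on_coset_tuple[OF nor X] by (auto simp: verts_quot_Cay)
  moreover have "full_graph_epi \<Delta> (?\<Gamma> i) (\<lambda>u. u i)" if i: "i \<in> I" for i
  proof -
    have "(\<lambda>u. u i) \<in> verts \<Delta> \<rightarrow> verts (?\<Gamma> i)" using pverts[OF i] by blast
    moreover have "\<forall>e\<in>edges \<Delta>. (\<lambda>u. u i) ` e \<in> edges (?\<Gamma> i)" using pedges[OF i] by blast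
    ultimately show ?thesis
      unfolding full_graph_epi_def graph_epi_def full_graph_hom_def graph_hom_def
      using s\<Delta> simple(1)[OF i] pverts[OF i] pedges[OF i] by simp
  qed
  then have "full_subdirect_product I ?\<Gamma> \<Delta>"
    unfolding full_subdirect_product_def is_subgraph_def using s\<Delta> sP vsub esub by simp
  ultimately show ?thesis by blast
qed

lemma (in group) Cayley_decomposition_max_inv_normals:
  assumes fin: "finite (carrier G)" and gen: "inverse_closed_generating_set G C"
    and net: "normal_edge_transitive G C"
    and I: "finite I" "I \<noteq> {}" and N: "\<And>i. i \<in> I \<Longrightarrow> N i \<in> max_inv_normals G C"
  shows "Cayley_decomposition G C I N"
proof -
  have C: "C \<subseteq> carrier G" using gen by (auto simp: inverse_closed_generating_set_def)
  have Ni: "N i \<in> inv_normals G C" if "i \<in> I" for i using N[OF that] by (rule max_inv_normals_inv)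
  have X: "(\<Inter>i\<in>I. N i) \<in> inv_normals G C" using I(2) Ni by (rule INT_inv_normals)
  have genq: "inverse_closed_generating_set (G Mod M) (quot_set G C M)"
    if M: "M \<in> inv_normals G C" for M
    using normal.inverse_closed_generating_set_quot[OF inv_normals_normal[OF M] gen]
      generators_avoid_inv_normals[OF gen net M] by blast
  have simple: "simple_graph (quot_Cay G C M)" if M: "M \<in> inv_normals G C" for M
    using inv_normals_normal[OF M] fin genq[OF M] by (rule simple_graph_quot_Cay)
  have "finite (carrier (G Mod N i)) \<and> characteristically_simple (G Mod N i) \<and>
     inverse_closed_generating_set (G Mod N i) (quot_set G C (N i)) \<and>
     graph_connected (quot_Cay G C (N i)) \<and>
     normal_edge_transitive (G Mod N i) (quot_set G C (N i))" if i: "i \<in> I" for i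
  proof (intro conjI)
    show "finite (carrier (G Mod N i))" using fin by (rule finite_carrier_FactGroup)
    show "characteristically_simple (G Mod N i)" using N[OF i] by (rule characteristically_simple_quot)
    show gq: "inverse_closed_generating_set (G Mod N i) (quot_set G C (N i))" using genq[OF Ni[OF i]] .
    interpret M: normal "N i" G using Ni[OF i] by (rule inv_normals_normal)
    show "graph_connected (quot_Cay G C (N i))"
      unfolding quot_Cay_def using group.graph_connected_Cay[OF M.factorgroup_is_group gq] .
    show "normal_edge_transitive (G Mod N i) (quot_set G C (N i))"
      using Ni[OF i] by (intro M.normal_edge_transitive_quot[OF C net]) (auto simp: inv_normals_def)
  qed
  moreover have "\<exists>\<Delta>. full_subdirect_product I (\<lambda>i. quot_Cay G C (N i)) \<Delta> \<and>
           graph_iso (quot_Cay G C (\<Inter>i\<in>I. N i)) \<Delta> (coset_tuple G I N)"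
    using Ni X by (intro Cayley_graph_subdirect[OF fin I C] simple) (auto intro: inv_normals_normal)
  ultimately show ?thesis by (simp add: Cayley_decomposition_def)
qed

section \<open>Existence of maximal members and the conclusion\<close>

lemma finite_inv_normals:
  assumes "finite (carrier G)"
  shows "finite (inv_normals G C)"
proof (rule finite_subset)
  show "inv_normals G C \<subseteq> Pow (carrier G)"
    by (auto simp: inv_normals_def dest!: normal_imp_subgroup subgroup.subset)
qed (use assms in simp)

lemma (in group) max_inv_normals_nonempty:
  assumes "finite (carrier G)" "carrier G \<noteq> {\<one>}"
  shows "max_inv_normals G C \<noteq> {}"
proof -
  have "\<sigma> ` {\<one>} = {\<one>}" if "\<sigma> \<in> Aut_pres G C" for \<sigma>
    using that hom_one[of \<sigma> G G] is_group by (simp add: Aut_pres_def autoD)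
  then have "{\<one>} \<in> inv_normals G C"
    using assms(2) one_is_normal by (auto simp: inv_normals_def)
  then obtain M where "M \<in> inv_normals G C" "\<forall>K\<in>inv_normals G C. M \<subseteq> K \<longrightarrow> M = K"
    using finite_has_maximal[OF finite_inv_normals[OF assms(1)]] by auto
  then show ?thesis by (auto simp: max_inv_normals_def)
qed

theorem theorem3p2:
  fixes G :: "('a, 'b) monoid_scheme" and C :: "'a set"
  assumes "group G" and "finite (carrier G)" and "carrier G \<noteq> {\<one>\<^bsub>G\<^esub>}"
    and "inverse_closed_generating_set G C"
    and "normal_edge_transitive G C"
  shows "(\<exists>(k::nat) N. 1 \<le> k \<and> (\<forall>i\<in>{1..k}. N i \<in> max_inv_normals G C) \<and>
            quotient_decomposition G C {1..k} N \<and> Cayley_decomposition G C {1..k} N) \<and>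
         (\<forall>Y. (Y \<in> decomposing_intersections G C \<and>
                 (\<forall>X\<in>decomposing_intersections G C. Y \<subseteq> X)) \<longleftrightarrow>
               Y = Frattini_rel G C)"
proof -
  interpret group G by fact
  have fin: "finite (max_inv_normals G C)"
    using finite_inv_normals[OF assms(2)] by (simp add: max_inv_normals_def)
  obtain S where S: "S \<subseteq> max_inv_normals G C" "S \<noteq> {}" "\<Inter>S = Frattini_rel G C"
    and ind: "coset_independent S"
    using ex_coset_independent_subfamily[OF fin max_inv_normals_nonempty[OF assms(2,3)] order.refl]
    by (auto simp: Frattini_rel_def)
  have finS: "finite S" using S(1) fin finite_subset by blast
  \<comment> \<open>Numbering \<open>S\<close> bijectively from 1 gives the index set
    \<open>{1..k}\<close> with \<open>k = card S\<close> and the injectivity needed for the group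
    isomorphism.\<close>
  then obtain N where N: "bij_betw N {1..card S} S"
    using ex_bij_betw_nat_finite_1 by blast
  let ?I = "{1..card S}"
  have im: "N ` ?I = S" and inj: "inj_on N ?I" using N by (auto simp: bij_betw_def)
  have k: "1 \<le> card S" using finS S(2) by (simp add: Suc_leI card_gt_0_iff)
  then have ne: "?I \<noteq> {}" by simp
  have max: "N i \<in> max_inv_normals G C" if "i \<in> ?I" for i using that im S(1) by blast
  have q: "quotient_decomposition G C ?I N"
    using ne inj max ind im by (intro quotient_decomposition_coset_independent) (auto intro: max_inv_normals_inv)
  have c: "Cayley_decomposition G C ?I N"
    using Cayley_decomposition_max_inv_normals[OF assms(2,4,5) finite_atLeastAtMost ne max] .
  have "Frattini_rel G C = (\<Inter>i\<in>?I. N i)" using S(3) im by simp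
  then have "Frattini_rel G C \<in> decomposing_intersections G C"
    unfolding decomposing_intersections_def using k max q c by blast
  \<comment> \<open>Each such \<open>X\<close> intersects only some members of
    \<open>max_inv_normals G C\<close>, whereas \<open>Frattini_rel G C\<close> intersects all of
    them.\<close>
  moreover have "Frattini_rel G C \<subseteq> X" if "X \<in> decomposing_intersections G C" for X
    using that unfolding decomposing_intersections_def Frattini_rel_def by blast
  ultimately have "(Y \<in> decomposing_intersections G C \<and>
      (\<forall>X\<in>decomposing_intersections G C. Y \<subseteq> X)) \<longleftrightarrow> Y = Frattini_rel G C" for Y
    by (metis subset_antisym)
  with k max q c show ?thesis by blast
qed

end
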